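(* Let $M\ge 2$ be an integer and let $\kappa_1,\kappa_2\in\mathbb{R}$ satisfy $\kappa_1>0$ and $\kappa_1+4\kappa_2>0$. Let $\Theta$ be the memory kernel of the generalized Langevin equation for the one-dimensional lattice with first and second neighbor force constants $\kappa_1,\kappa_2$, where the coarse-grained variables are defined with piecewise linear (hat) weighting functions with block size $M$. Explicitly, $$\Theta_{0,0}(0)=\frac{1}{2\pi}\int_0^{2\pi}\widehat\Phi^{*}\widehat{\mathcal A}\,\widehat\Psi\left(\widehat\Psi^{*}\widehat{\mathcal A}\,\widehat\Psi\right)^{-1}\widehat\Psi^{*}\widehat{\mathcal A}\,\widehat\Phi\,d\xi .$$ Then $$\Theta_{0,0}(0)\le\frac{2M\kappa_1+8M\kappa_2-6\kappa_2}{M(2M^2+1)/3}.$$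
   Context: Lattice operator. Set $\kappa_0=2(\kappa_1+\kappa_2)$ and let $\mathcal A$ act on $\ell^2(\mathbb Z)$ by $(\mathcal A u)_j=-\kappa_2u_{j-2}-\kappa_1u_{j-1}+\kappa_0u_j-\kappa_1u_{j+1}-\kappa_2u_{j+2}$. Grouping the sites into consecutive blocks of $M$ sites, $\mathcal A$ becomes a block tridiagonal block Toeplitz operator with $M\times M$ blocks: diagonal block $A_0$, sub-diagonal block $A_1$, super-diagonal block $A_{-1}=A_1^{\intercal}$. Here $(A_0)_{ij}=\kappa_0$ if $i=j$, $-\kappa_1$ if $|i-j|=1$, $-\kappa_2$ if $|i-j|=2$, and $0$ otherwise; the only nonzero entries of $A_1$ are $A_1(1,M)=-\kappa_1$ and $A_1(1,M-1)=A_1(2,M)=-\kappa_2$. The Fourier transform (symbol) is $$\widehat{\mathcal A}(\xi)=A_0+e^{-i\xi}A_1+e^{i\xi}A_1^{\intercal},\qquad \xi\in(0,2\pi].$$ Piecewise linear averaging. Let $c=\sqrt{\tfrac13(2M^3+M)}$ and $$h_1=\tfrac1c(1,2,\dots,M)^{\intercal},\qquad h_2=\tfrac1c(M-1,M-2,\dots,1,0)^{\intercal}\in\mathbb R^M .$$ The operator $\Phi$ is block lower bidiagonal with main diagonal block $h_1$ and first sub-diagonal block $h_2$ (so each column is a normalized hat function spread over two adjacent blocks), with symbol $\widehat\Phi(\xi)=h_1+e^{-i\xi}h_2\in\mathbb C^M$. For each $\xi$, $\widehat\Psi(\xi)\in\mathbb C^{M\times(M-1)}$ is a matrix whose columns form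 a basis of the orthogonal complement of $\widehat\Phi(\xi)$ in $\mathbb C^M$ (the integrand in the claim does not depend on the choice of basis). A superscript $*$ denotes the conjugate transpose. Kernel. The memory kernel is $\Theta(t)=\Phi^{\intercal}\mathcal A\Psi\cos(\Omega t)\Omega^{-2}\Psi^{\intercal}\mathcal A\Phi$ with $\Omega^2=\Psi^{\intercal}\mathcal A\Psi$; for this averaging its $(0,0)$ entry at $t=0$ is the integral displayed in the claim. *)

theory Defs
  imports "HOL-Analysis.Analysis" "Jordan_Normal_Form.Schur_Decomposition"
begin

text \<open>
  Matrices and vectors are those of Jordan_Normal_Form, whose indices start at \<open>0\<close>: row \<open>i\<close> and
  column \<open>j\<close> below are row \<open>i + 1\<close> and column \<open>j + 1\<close> in the usual one-based convention.
\<close>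

text \<open>
  The blocks of the lattice operator
  \<open>(A u)\<^sub>j = - \<kappa>\<^sub>2 u\<^bsub>j-2\<^esub> - \<kappa>\<^sub>1 u\<^bsub>j-1\<^esub> + \<kappa>\<^sub>0 u\<^sub>j - \<kappa>\<^sub>1 u\<^bsub>j+1\<^esub> - \<kappa>\<^sub>2 u\<^bsub>j+2\<^esub>\<close> with
  \<open>\<kappa>\<^sub>0 = 2 (\<kappa>\<^sub>1 + \<kappa>\<^sub>2)\<close>, for consecutive blocks of \<open>M \<ge> 2\<close> sites.
\<close>

definition diag_block :: "nat \<Rightarrow> real \<Rightarrow> real \<Rightarrow> complex mat" where
  "diag_block M \<kappa>\<^sub>1 \<kappa>\<^sub>2 = Matrix.mat M M (\<lambda>(i, j). complex_of_real
     (if i = j then 2 * (\<kappa>\<^sub>1 + \<kappa>\<^sub>2)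
      else if \<bar>int i - int j\<bar> = 1 then - \<kappa>\<^sub>1
      else if \<bar>int i - int j\<bar> = 2 then - \<kappa>\<^sub>2
      else 0))"

definition subdiag_block :: "nat \<Rightarrow> real \<Rightarrow> real \<Rightarrow> complex mat" where
  "subdiag_block M \<kappa>\<^sub>1 \<kappa>\<^sub>2 = Matrix.mat M M (\<lambda>(i, j). complex_of_real
     (if i = 0 \<and> j = M - 1 then - \<kappa>\<^sub>1
      else if i = 0 \<and> j = M - 2 \<or> i = 1 \<and> j = M - 1 then - \<kappa>\<^sub>2
      else 0))"

definition lattice_symbol :: "nat \<Rightarrow> real \<Rightarrow> real \<Rightarrow> real \<Rightarrow> complex mat" where
  "lattice_symbol M \<kappa>\<^sub>1 \<kappa>\<^sub>2 \<xi> =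
     diag_block M \<kappa>\<^sub>1 \<kappa>\<^sub>2
     + cis (- \<xi>) \<cdot>\<^sub>m subdiag_block M \<kappa>\<^sub>1 \<kappa>\<^sub>2
     + cis \<xi> \<cdot>\<^sub>m transpose_mat (subdiag_block M \<kappa>\<^sub>1 \<kappa>\<^sub>2)"

definition hat_norm :: "nat \<Rightarrow> real" where
  "hat_norm M = sqrt ((2 * real M ^ 3 + real M) / 3)"

definition hat_rising :: "nat \<Rightarrow> complex Matrix.vec" where
  "hat_rising M = Matrix.vec M (\<lambda>i. complex_of_real (real (i + 1) / hat_norm M))"

definition hat_falling :: "nat \<Rightarrow> complex Matrix.vec" where
  "hat_falling M = Matrix.vec M (\<lambda>i. complex_of_real ((real M - real (i + 1)) / hat_norm M))"

definition hat_symbol :: "nat \<Rightarrow> real \<Rightarrow> complex Matrix.vec" where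
  "hat_symbol M \<xi> = hat_rising M + cis (- \<xi>) \<cdot>\<^sub>v hat_falling M"

definition orth_compl :: "nat \<Rightarrow> complex Matrix.vec \<Rightarrow> complex Matrix.vec set" where
  "orth_compl n v = {w \<in> carrier_vec n. w \<bullet>c v = 0}"

text \<open>
  Distinctness is required separately, since \<open>basis\<close> only sees the set of columns.
\<close>

definition cols_basis_orth_compl :: "nat \<Rightarrow> complex Matrix.vec \<Rightarrow> complex mat \<Rightarrow> bool" where
  "cols_basis_orth_compl n v P \<longleftrightarrow>
     P \<in> carrier_mat n (n - 1) \<and>
     distinct (cols P) \<and>
     vectorspace.basis class_ring
       ((module_vec TYPE(complex) n)\<lparr>carrier := orth_compl n v\<rparr>) (set (cols P))"

definition Omega_sq_symbol :: "nat \<Rightarrow> real \<Rightarrow> real \<Rightarrow> (real \<Rightarrow> complex mat) \<Rightarrow> real \<Rightarrow> complex mat" where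
  "Omega_sq_symbol M \<kappa>\<^sub>1 \<kappa>\<^sub>2 \<Psi> \<xi> =
     mat_adjoint (\<Psi> \<xi>) * lattice_symbol M \<kappa>\<^sub>1 \<kappa>\<^sub>2 \<xi> * \<Psi> \<xi>"

text \<open>
  The product \<open>\<Phi>\<^sup>* B \<Phi>\<close> with a column vector \<open>\<Phi>\<close> is the scalar \<open>(B \<Phi>) \<bullet>c \<Phi>\<close>, because \<open>\<bullet>c\<close>
  conjugates its second argument.
\<close>

definition memory_integrand ::
    "nat \<Rightarrow> real \<Rightarrow> real \<Rightarrow> (real \<Rightarrow> complex mat) \<Rightarrow> real \<Rightarrow> complex" where
  "memory_integrand M \<kappa>\<^sub>1 \<kappa>\<^sub>2 \<Psi> \<xi> =
     ((lattice_symbol M \<kappa>\<^sub>1 \<kappa>\<^sub>2 \<xi> * \<Psi> \<xi>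
       * the (mat_inverse (Omega_sq_symbol M \<kappa>\<^sub>1 \<kappa>\<^sub>2 \<Psi> \<xi>))
       * mat_adjoint (\<Psi> \<xi>) * lattice_symbol M \<kappa>\<^sub>1 \<kappa>\<^sub>2 \<xi>) *\<^sub>v hat_symbol M \<xi>)
     \<bullet>c hat_symbol M \<xi>"

text \<open>
  The entry \<open>\<Theta>\<^bsub>0,0\<^esub>(0)\<close> of the memory kernel at time \<open>0\<close>, in its Fourier representation.
\<close>

definition memory_kernel_00 :: "nat \<Rightarrow> real \<Rightarrow> real \<Rightarrow> (real \<Rightarrow> complex mat) \<Rightarrow> complex" where
  "memory_kernel_00 M \<kappa>\<^sub>1 \<kappa>\<^sub>2 \<Psi> =
     1 / (2 * complex_of_real pi) * integral {0..2 * pi} (memory_integrand M \<kappa>\<^sub>1 \<kappa>\<^sub>2 \<Psi>)"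

end

theory Submission
  imports Defs "Jordan_Normal_Form.DL_Rank"
begin

text \<open>
  Fix \<open>\<xi>\<close>, write \<open>A\<close> for the Hermitian symbol of the lattice operator, \<open>u\<close> for that of the hat
  functions and \<open>Q v = v\<^sup>* A v\<close>. The integrand equals \<open>Q (P y)\<close>, where \<open>P y\<close> is the \<open>Q\<close>-orthogonal
  projection of \<open>u\<close> onto the orthogonal complement of \<open>u\<close>; hence it lies between \<open>0\<close> and \<open>Q u\<close>,
  and integrating \<open>Q u\<close> gives exactly the claimed bound. Positivity of \<open>Q\<close> comes from
  \<open>Q v = \<kappa>\<^sub>1 D\<^sub>1 + \<kappa>\<^sub>2 D\<^sub>2\<close> with \<open>D\<^sub>r\<close> the sum of squared differences at distance \<open>r\<close> of the
  quasi-periodic extension of \<open>v\<close>, and \<open>D\<^sub>2 \<le> 4 D\<^sub>1\<close>. The integrand is integrable although \<open>\<Psi>\<close> may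
  depend wildly on \<open>\<xi>\<close>: on \<open>(0, 2\<pi>)\<close> the symbol is invertible and the integrand is
  \<open>Q u - (u\<^sup>* u)\<^sup>2 / (u\<^sup>* A\<^sup>-\<^sup>1 u)\<close>, which is continuous.
\<close>

unbundle no vec_syntax

section \<open>Compressions of Hermitian matrices to an orthogonal complement\<close>

lemma mat_adjoint_carrier [simp]:
  "A \<in> carrier_mat n m \<Longrightarrow> mat_adjoint A \<in> carrier_mat m n"
  unfolding mat_adjoint_def by (intro carrier_matI) auto

lemma mat_adjoint_index:
  "A \<in> carrier_mat n m \<Longrightarrow> i < m \<Longrightarrow> j < n \<Longrightarrow> mat_adjoint A $$ (i, j) = conjugate (A $$ (j, i))"
  unfolding mat_adjoint_def by (subst mat_of_rows_index) auto

lemma cscalar_prod_sum: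
  fixes v w :: "complex Matrix.vec"
  assumes "w \<in> carrier_vec n"
  shows "v \<bullet>c w = (\<Sum>i<n. v $ i * cnj (w $ i))"
  using assms by (auto simp: scalar_prod_def lessThan_atLeast0)

lemma mult_mat_vec_index_sum:
  assumes "A \<in> carrier_mat n m" "v \<in> carrier_vec m" "i < n"
  shows "(A *\<^sub>v v) $ i = (\<Sum>j<m. A $$ (i, j) * v $ j)"
  using assms by (auto simp: scalar_prod_def lessThan_atLeast0)

lemma cscalar_prod_mat_adjoint:
  fixes A :: "complex mat"
  assumes "A \<in> carrier_mat n m" "v \<in> carrier_vec m" "w \<in> carrier_vec n"
  shows "(A *\<^sub>v v) \<bullet>c w = v \<bullet>c (mat_adjoint A *\<^sub>v w)"
proof -
  have "(A *\<^sub>v v) \<bullet>c w = (\<Sum>i<n. (\<Sum>j<m. A $$ (i, j) * v $ j) * cnj (w $ i))"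
    unfolding cscalar_prod_sum[OF assms(3)]
    by (intro sum.cong refl) (simp add: mult_mat_vec_index_sum[OF assms(1,2)])
  also have "\<dots> = (\<Sum>j<m. \<Sum>i<n. A $$ (i, j) * v $ j * cnj (w $ i))"
    unfolding sum_distrib_right by (rule sum.swap)
  also have "\<dots> = (\<Sum>j<m. v $ j * cnj (\<Sum>i<n. mat_adjoint A $$ (j, i) * w $ i))"
    by (intro sum.cong refl)
      (auto simp: sum_distrib_left mat_adjoint_index[OF assms(1)] mult_ac intro!: sum.cong)
  also have "\<dots> = v \<bullet>c (mat_adjoint A *\<^sub>v w)"
  proof -
    have "mat_adjoint A *\<^sub>v w \<in> carrier_vec m"
      using assms mult_mat_vec_carrier mat_adjoint_carrier by blast
    then show ?thesis
      unfolding cscalar_prod_sum[OF \<open>mat_adjoint A *\<^sub>v w \<in> carrier_vec m\<close>]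
      by (intro sum.cong refl)
        (simp add: mult_mat_vec_index_sum[OF mat_adjoint_carrier[OF assms(1)] assms(3)])
  qed
  finally show ?thesis .
qed

lemma cnj_cscalar_prod:
  fixes v w :: "complex Matrix.vec"
  assumes "v \<in> carrier_vec n" "w \<in> carrier_vec n"
  shows "cnj (v \<bullet>c w) = w \<bullet>c v"
  unfolding cscalar_prod_sum[OF assms(1)] cscalar_prod_sum[OF assms(2)] by (simp add: mult.commute)

section \<open>Bases of an orthogonal complement\<close>

context vec_space
begin

text \<open>Span and linear dependence taken inside a submodule agree with those of the ambient
  space, so generation by the columns identifies \<open>N\<close> with the column space.
  Independence only speaks of the set of columns; distinctness is what turns a nonzero kernel vector
  of \<open>P\<close> into a dependence of that set.\<close>

lemma basis_of_submodule_cols: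
  assumes P: "P \<in> carrier_mat n k" and dist: "distinct (cols P)"
    and sub: "submodule class_ring N V"
    and basis: "vectorspace.basis class_ring (V\<lparr>carrier := N\<rparr>) (set (cols P))"
  shows "N = {P *\<^sub>v y | y. y \<in> carrier_vec k}"
    and "\<And>y. y \<in> carrier_vec k \<Longrightarrow> P *\<^sub>v y = 0\<^sub>v n \<Longrightarrow> y = 0\<^sub>v k"
proof -
  have "vectorspace class_ring (V\<lparr>carrier := N\<rparr>)"
    unfolding vectorspace_def using submodule_is_module[OF sub] by (simp add: field_axioms)
  from basis[unfolded vectorspace.basis_def[OF this]]
  have indpt: "\<not> LinearCombinations.module.lin_dep class_ring (V\<lparr>carrier := N\<rparr>) (set (cols P))"
    and gen: "LinearCombinations.module.span class_ring (V\<lparr>carrier := N\<rparr>) (set (cols P)) = N"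
    and sN: "set (cols P) \<subseteq> N" by auto
  have "span (set (cols P)) = N"
    using span_li_not_depend(1)[OF sN sub] gen by simp
  then have "N = col_space P" by (simp add: col_space_def)
  moreover have "\<dots> = {P *\<^sub>v y | y. y \<in> carrier_vec k}"
    unfolding col_space_eq[OF P] using P by auto
  ultimately show "N = {P *\<^sub>v y | y. y \<in> carrier_vec k}" by simp
  have "\<not> lin_dep (set (cols P))"
    using span_li_not_depend(2)[OF sN sub] indpt by simp
  then show "\<And>y. y \<in> carrier_vec k \<Longrightarrow> P *\<^sub>v y = 0\<^sub>v n \<Longrightarrow> y = 0\<^sub>v k"
    using lin_depI[OF P _ _ _ dist] by blast
qed

end

lemma submodule_orth_compl:
  assumes "u \<in> carrier_vec n"
  shows "submodule class_ring (orth_compl n u) (module_vec TYPE(complex) n)"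
proof -
  interpret vec_space "TYPE(complex)" n .
  note [simp] = module_vec_simps class_ring_simps
  show ?thesis
  proof (rule submodule.intro)
    show "Module.module class_ring (module_vec TYPE(complex) n)" ..
  qed (use assms in \<open>auto simp: orth_compl_def add_scalar_prod_distrib[of _ n] module_vec_def\<close>)
qed

lemma cols_basis_orth_complD:
  assumes u: "u \<in> carrier_vec n" and basis: "cols_basis_orth_compl n u P"
  shows "P \<in> carrier_mat n (n - 1)"
    and "orth_compl n u = {P *\<^sub>v y | y. y \<in> carrier_vec (n - 1)}"
    and "\<And>y. y \<in> carrier_vec (n - 1) \<Longrightarrow> P *\<^sub>v y = 0\<^sub>v n \<Longrightarrow> y = 0\<^sub>v (n - 1)"
proof -
  have P: "P \<in> carrier_mat n (n - 1)" "distinct (cols P)"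
    "vectorspace.basis class_ring
       ((module_vec TYPE(complex) n)\<lparr>carrier := orth_compl n u\<rparr>) (set (cols P))"
    using basis by (auto simp: cols_basis_orth_compl_def)
  note * = vec_space.basis_of_submodule_cols[OF P(1,2) submodule_orth_compl[OF u] P(3)]
  show "P \<in> carrier_mat n (n - 1)"
    and "orth_compl n u = {P *\<^sub>v y | y. y \<in> carrier_vec (n - 1)}"
    and "\<And>y. y \<in> carrier_vec (n - 1) \<Longrightarrow> P *\<^sub>v y = 0\<^sub>v n \<Longrightarrow> y = 0\<^sub>v (n - 1)"
    using P(1) * by simp_all
qed

section \<open>Invertibility of compressions\<close>

lemma mat_inverseE:
  fixes N :: "'a :: field mat"
  assumes N: "N \<in> carrier_mat n n"
    and inj: "\<And>y. y \<in> carrier_vec n \<Longrightarrow> N *\<^sub>v y = 0\<^sub>v n \<Longrightarrow> y = 0\<^sub>v n"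
  obtains B where "mat_inverse N = Some B" "B \<in> carrier_mat n n" "N * B = 1\<^sub>m n" "B * N = 1\<^sub>m n"
proof -
  have "det N \<noteq> 0" using det_0_iff_vec_prod_zero_field[OF N] inj by blast
  then have "N \<in> Units (ring_mat TYPE('a) n ())" by (rule det_non_zero_imp_unit[OF N])
  \<comment> \<open>\<open>mat_inverse\<close> returns \<open>None\<close> only for matrices that
    are not units.\<close>
  then obtain B where "mat_inverse N = Some B"
    using mat_inverse(1)[OF N, of "()"] by (cases "mat_inverse N") auto
  with mat_inverse(2)[OF N this] that show thesis by blast
qed

lemma compression_mult_vec:
  assumes A: "A \<in> carrier_mat n n" and P: "(P :: complex mat) \<in> carrier_mat n k"
    and y: "y \<in> carrier_vec k"
  shows "(mat_adjoint P * A * P) *\<^sub>v y = mat_adjoint P *\<^sub>v (A *\<^sub>v (P *\<^sub>v y))"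
proof -
  note P' = mat_adjoint_carrier[OF P]
  have "(mat_adjoint P * A * P) *\<^sub>v y = (mat_adjoint P * A) *\<^sub>v (P *\<^sub>v y)"
    using assms P' by (intro assoc_mult_mat_vec[of _ k n _ k] mult_carrier_mat) auto
  also have "\<dots> = mat_adjoint P *\<^sub>v (A *\<^sub>v (P *\<^sub>v y))"
    using assms P' by (intro assoc_mult_mat_vec[of _ k n _ n]) auto
  finally show ?thesis .
qed

text \<open>Moving \<open>P\<close> to the other side shows that \<open>N y = 0\<close>, for the
  compression \<open>N\<close>, makes the form of \<open>A\<close> vanish at \<open>P y\<close>.
  This vector lies in the orthogonal complement, where the form is definite, so
  \<open>P y = 0\<close>, and the columns of \<open>P\<close> are independent.\<close>

lemma compression_injective:
  fixes A P :: "complex mat"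
  assumes A: "A \<in> carrier_mat n n" and u: "u \<in> carrier_vec n"
    and basis: "cols_basis_orth_compl n u P"
    and definite: "\<And>v. v \<in> orth_compl n u \<Longrightarrow> (A *\<^sub>v v) \<bullet>c v = 0 \<Longrightarrow> v = 0\<^sub>v n"
    and y: "y \<in> carrier_vec (n - 1)" and 0: "(mat_adjoint P * A * P) *\<^sub>v y = 0\<^sub>v (n - 1)"
  shows "y = 0\<^sub>v (n - 1)"
proof -
  note P = cols_basis_orth_complD[OF u basis]
  have Py: "P *\<^sub>v y \<in> orth_compl n u" using P(2) y by blast
  then have Py': "P *\<^sub>v y \<in> carrier_vec n" by (simp add: orth_compl_def)
  have APy: "A *\<^sub>v (P *\<^sub>v y) \<in> carrier_vec n" using A Py' by simp
  have "(P *\<^sub>v y) \<bullet>c (A *\<^sub>v (P *\<^sub>v y)) = y \<bullet>c 0\<^sub>v (n - 1)"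
    using cscalar_prod_mat_adjoint[OF P(1) y APy] 0 compression_mult_vec[OF A P(1) y] by simp
  also have "\<dots> = 0" using y by simp
  finally have "(A *\<^sub>v (P *\<^sub>v y)) \<bullet>c (P *\<^sub>v y) = 0"
    using cnj_cscalar_prod[OF APy Py'] by (metis complex_cnj_zero_iff)
  from definite[OF Py this] P(3)[OF y] show ?thesis by simp
qed

lemma invertible_matI_injective:
  fixes N :: "'a :: field mat"
  assumes N: "N \<in> carrier_mat n n"
    and inj: "\<And>y. y \<in> carrier_vec n \<Longrightarrow> N *\<^sub>v y = 0\<^sub>v n \<Longrightarrow> y = 0\<^sub>v n"
  shows "invertible_mat N"
proof -
  obtain B where B: "B \<in> carrier_mat n n" "N * B = 1\<^sub>m n" "B * N = 1\<^sub>m n"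
    using mat_inverseE[OF N inj] by metis
  then show ?thesis
    using N unfolding invertible_mat_def inverts_mat_def by auto
qed

text \<open>The remainder \<open>d\<close> of the orthogonal projection of \<open>z\<close> onto
  \<open>u\<close> is orthogonal to \<open>u\<close>, hence by \<open>orth\<close> also to
  \<open>z\<close>. It is therefore orthogonal to itself.\<close>

lemma in_span_of_orth_orth_compl:
  assumes u: "u \<in> carrier_vec n" and z: "z \<in> carrier_vec n"
    and u0: "u \<bullet>c u \<noteq> 0"
    and orth: "\<And>v. v \<in> orth_compl n u \<Longrightarrow> z \<bullet>c v = 0"
  shows "z = ((z \<bullet>c u) / (u \<bullet>c u)) \<cdot>\<^sub>v u"
proof -
  define c where "c = (z \<bullet>c u) / (u \<bullet>c u)"
  define d where "d = z - c \<cdot>\<^sub>v u"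
  have d: "d \<in> carrier_vec n" using u z by (simp add: d_def)
  have du: "d \<bullet>c u = 0"
    using u z u0 by (simp add: d_def minus_scalar_prod_distrib[of _ n] c_def)
  then have "d \<in> orth_compl n u" using d by (simp add: orth_compl_def)
  then have "z \<bullet>c d = 0" by (rule orth)
  moreover have "u \<bullet>c d = 0" using du cnj_cscalar_prod[OF d u] by (metis complex_cnj_zero_iff)
  moreover have "d \<bullet>c d = z \<bullet>c d - c * (u \<bullet>c d)"
    using u z d by (subst d_def) (simp add: minus_scalar_prod_distrib[of _ n])
  ultimately have "d \<bullet>c d = 0" by simp
  then have "d = 0\<^sub>v n" using d by simp
  then have "z $ i = c * u $ i" if "i < n" for i
    using that u z by (metis d_def carrier_vecD index_minus_vec(1) index_smult_vec(1,2) index_zero_vec(1) eq_iff_diff_eq_0)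
  then show ?thesis using u z unfolding c_def by (intro eq_vecI) auto
qed

text \<open>
  With \<open>y = N\<^sup>-\<^sup>1 P\<^sup>* A u\<close> the vector \<open>w = u - P y\<close> satisfies \<open>P\<^sup>* A w = 0\<close>, so \<open>A w\<close> is a multiple
  of \<open>u\<close>.
\<close>

lemma compression_quadratic_form:
  fixes A P :: "complex mat"
  defines "N \<equiv> mat_adjoint P * A * P"
  defines "g u \<equiv> ((A * P * the (mat_inverse N) * mat_adjoint P * A) *\<^sub>v u) \<bullet>c u"
  assumes A: "A \<in> carrier_mat n n" and herm: "mat_adjoint A = A"
    and u: "u \<in> carrier_vec n"
    and basis: "cols_basis_orth_compl n u P"
    and psd: "\<And>v. v \<in> carrier_vec n \<Longrightarrow> \<exists>r\<ge>0. (A *\<^sub>v v) \<bullet>c v = complex_of_real r"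
    and definite: "\<And>v. v \<in> orth_compl n u \<Longrightarrow> (A *\<^sub>v v) \<bullet>c v = 0 \<Longrightarrow> v = 0\<^sub>v n"
  shows "\<exists>r. 0 \<le> r \<and> r \<le> Re ((A *\<^sub>v u) \<bullet>c u) \<and> g u = complex_of_real r"
    and "\<And>x. x \<in> carrier_vec n \<Longrightarrow> A *\<^sub>v x = u \<Longrightarrow> u \<bullet>c u \<noteq> 0 \<Longrightarrow>
           x \<bullet>c u \<noteq> 0 \<and> g u = (A *\<^sub>v u) \<bullet>c u - (u \<bullet>c u)\<^sup>2 / (x \<bullet>c u)"
proof -
  note P = cols_basis_orth_complD[OF u basis]
  note P' = mat_adjoint_carrier[OF P(1)]
  have N: "N \<in> carrier_mat (n - 1) (n - 1)" using A P(1) P' unfolding N_def by (intro mult_carrier_mat)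
  obtain B where inv: "mat_inverse N = Some B" and B: "B \<in> carrier_mat (n - 1) (n - 1)"
    and NB: "N * B = 1\<^sub>m (n - 1)"
    using mat_inverseE[OF N] compression_injective[OF A u basis definite] unfolding N_def by metis
  have Au: "A *\<^sub>v u \<in> carrier_vec n" using A u by simp
  define b where "b = mat_adjoint P *\<^sub>v (A *\<^sub>v u)"
  define y where "y = B *\<^sub>v b"
  define w where "w = u - P *\<^sub>v y"
  have b: "b \<in> carrier_vec (n - 1)" using Au P' by (simp add: b_def)
  have y: "y \<in> carrier_vec (n - 1)" using B b by (simp add: y_def)
  have Py: "P *\<^sub>v y \<in> carrier_vec n" using P(1) y by simp
  have APy: "A *\<^sub>v (P *\<^sub>v y) \<in> carrier_vec n" using A Py by simp
  have w: "w \<in> carrier_vec n" using u Py by (simp add: w_def)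
  have Aw: "A *\<^sub>v w \<in> carrier_vec n" using A w by simp
  have Aw_eq: "A *\<^sub>v w = A *\<^sub>v u - A *\<^sub>v (P *\<^sub>v y)"
    using A u Py by (simp add: w_def mult_minus_distrib_mat_vec)
  have self_adj: "(A *\<^sub>v v) \<bullet>c v' = v \<bullet>c (A *\<^sub>v v')"
    if "v \<in> carrier_vec n" "v' \<in> carrier_vec n" for v v'
    using cscalar_prod_mat_adjoint[OF A that] herm by simp
  have Ny: "N *\<^sub>v y = b"
  proof -
    have "N *\<^sub>v y = (N * B) *\<^sub>v b" unfolding y_def using assoc_mult_mat_vec[OF N B b] by simp
    then show ?thesis using NB b by simp
  qed
  \<comment> \<open>The choice of \<open>y\<close> solves the normal equations
    \<open>N y = b\<close>, and every \<open>v\<close> in the complement is in the range of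
    \<open>P\<close>.\<close>
  have Aw_orth: "(A *\<^sub>v w) \<bullet>c v = 0" if v: "v \<in> orth_compl n u" for v
  proof -
    obtain t where t: "t \<in> carrier_vec (n - 1)" "v = P *\<^sub>v t" using v P(2) by blast
    have "mat_adjoint P *\<^sub>v (A *\<^sub>v w) = b - N *\<^sub>v y"
      using mult_minus_distrib_mat_vec[OF P' Au APy] compression_mult_vec[OF A P(1) y]
      by (simp add: Aw_eq b_def N_def)
    then have "mat_adjoint P *\<^sub>v (A *\<^sub>v w) = 0\<^sub>v (n - 1)" using Ny b by simp
    then have "v \<bullet>c (A *\<^sub>v w) = 0"
      using cscalar_prod_mat_adjoint[OF P(1) t(1) Aw] t by simp
    moreover have "v \<in> carrier_vec n" using v by (simp add: orth_compl_def)
    ultimately show ?thesis using cnj_cscalar_prod[OF _ Aw] by (metis complex_cnj_zero_iff)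
  qed
  have Py_orth: "P *\<^sub>v y \<in> orth_compl n u" using P(2) y by blast
  have g: "g u = (A *\<^sub>v (P *\<^sub>v y)) \<bullet>c u"
  proof -
    have "(A * P * B * mat_adjoint P * A) *\<^sub>v u = (A * P * B * mat_adjoint P) *\<^sub>v (A *\<^sub>v u)"
      using A P(1) P' B u by (intro assoc_mult_mat_vec[of _ n n _ n] mult_carrier_mat) auto
    also have "\<dots> = (A * P * B) *\<^sub>v b" unfolding b_def
      using A P(1) P' B Au by (intro assoc_mult_mat_vec[of _ n "n - 1" _ n] mult_carrier_mat) auto
    also have "\<dots> = (A * P) *\<^sub>v y" unfolding y_def
      using A P(1) B b by (intro assoc_mult_mat_vec[of _ n "n - 1" _ "n - 1"] mult_carrier_mat) auto
    also have "\<dots> = A *\<^sub>v (P *\<^sub>v y)"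
      using A P(1) y by (intro assoc_mult_mat_vec[of _ n n _ "n - 1"]) auto
    finally show ?thesis by (simp add: g_def inv)
  qed
  have split: "(A *\<^sub>v u) \<bullet>c v = (A *\<^sub>v w) \<bullet>c v + (A *\<^sub>v (P *\<^sub>v y)) \<bullet>c v" if "v \<in> carrier_vec n" for v
    using that Au APy by (simp add: Aw_eq minus_scalar_prod_distrib[of _ n])
  have g_u: "g u = (A *\<^sub>v u) \<bullet>c u - (A *\<^sub>v w) \<bullet>c u" using g split[OF u] by simp
  \<comment> \<open>Since \<open>A w\<close> is orthogonal to \<open>P y\<close>, the vectors
    \<open>A u\<close> and \<open>A (P y)\<close> have the same product with \<open>P y\<close>.
    Conjugation and self-adjointness move \<open>A\<close> back to the first argument.\<close>
  have g_Py: "g u = (A *\<^sub>v (P *\<^sub>v y)) \<bullet>c (P *\<^sub>v y)"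
  proof -
    have "(A *\<^sub>v u) \<bullet>c (P *\<^sub>v y) = (A *\<^sub>v (P *\<^sub>v y)) \<bullet>c (P *\<^sub>v y)"
      using split[OF Py] Aw_orth[OF Py_orth] by simp
    then have "cnj ((A *\<^sub>v u) \<bullet>c (P *\<^sub>v y)) = cnj ((A *\<^sub>v (P *\<^sub>v y)) \<bullet>c (P *\<^sub>v y))" by simp
    then show ?thesis
      using g cnj_cscalar_prod[OF Au Py] cnj_cscalar_prod[OF APy Py] self_adj[OF Py u] self_adj[OF Py Py] by simp
  qed
  have "conjugate w = conjugate u - conjugate (P *\<^sub>v y)"
    unfolding w_def using u Py P(1) by (intro eq_vecI) auto
  then have "(A *\<^sub>v w) \<bullet>c w = (A *\<^sub>v w) \<bullet>c u - (A *\<^sub>v w) \<bullet>c (P *\<^sub>v y)"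
    using u Py Aw by (simp add: scalar_prod_minus_distrib[of _ n])
  then have w_form: "(A *\<^sub>v w) \<bullet>c w = (A *\<^sub>v w) \<bullet>c u" using Aw_orth[OF Py_orth] by simp
  obtain r s where rs: "0 \<le> r" "(A *\<^sub>v (P *\<^sub>v y)) \<bullet>c (P *\<^sub>v y) = complex_of_real r"
    "0 \<le> s" "(A *\<^sub>v w) \<bullet>c w = complex_of_real s"
    using psd[OF Py] psd[OF w] by blast
  \<comment> \<open>Pythagoras for the form of \<open>A\<close>: \<open>Q u = Q (P y) + Q w\<close>
    with both terms nonnegative, which gives the upper bound on \<open>r\<close>.\<close>
  have "(A *\<^sub>v u) \<bullet>c u = of_real (r + s)" using g_u g_Py w_form rs by (simp add: algebra_simps)
  then show "\<exists>r. 0 \<le> r \<and> r \<le> Re ((A *\<^sub>v u) \<bullet>c u) \<and> g u = complex_of_real r"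
    using rs g_Py by (intro exI[of _ r]) simp
  fix x assume x: "x \<in> carrier_vec n" "A *\<^sub>v x = u" and u0: "u \<bullet>c u \<noteq> 0"
  \<comment> \<open>The multiplier in \<open>A w = c u\<close> is found by pairing with
    \<open>x\<close>, a preimage of \<open>u\<close> under \<open>A\<close>: the left side becomes
    the product of \<open>w\<close> with \<open>u\<close>, which equals that of \<open>u\<close>
    with itself because \<open>P y\<close> is orthogonal to \<open>u\<close>.\<close>
  define c where "c = ((A *\<^sub>v w) \<bullet>c u) / (u \<bullet>c u)"
  have Aw_c: "A *\<^sub>v w = c \<cdot>\<^sub>v u"
    unfolding c_def using in_span_of_orth_orth_compl[OF u Aw u0 Aw_orth] .
  have ux: "u \<bullet>c x = x \<bullet>c u" using self_adj[OF x(1) x(1)] x(2) by simp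
  have "w \<bullet>c u = u \<bullet>c u - (P *\<^sub>v y) \<bullet>c u"
    using u Py by (simp add: w_def minus_scalar_prod_distrib[of _ n])
  then have wu: "w \<bullet>c u = u \<bullet>c u" using Py_orth by (simp add: orth_compl_def)
  have "(A *\<^sub>v w) \<bullet>c x = w \<bullet>c u" using self_adj[OF w x(1)] x(2) by simp
  moreover have "(A *\<^sub>v w) \<bullet>c x = c * (u \<bullet>c x)" using Aw_c u x by simp
  ultimately have cx: "c * (x \<bullet>c u) = u \<bullet>c u" using ux wu by simp
  have "g u = (A *\<^sub>v u) \<bullet>c u - c * (u \<bullet>c u)" using g_u Aw_c u by simp
  moreover have "x \<bullet>c u \<noteq> 0" using cx u0 by auto
  moreover have "(u \<bullet>c u)\<^sup>2 = c * (u \<bullet>c u) * (x \<bullet>c u)" by (simp add: power2_eq_square flip: cx)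
  ultimately show "x \<bullet>c u \<noteq> 0 \<and> g u = (A *\<^sub>v u) \<bullet>c u - (u \<bullet>c u)\<^sup>2 / (x \<bullet>c u)" by simp
qed

section \<open>The quadratic form of the lattice symbol\<close>

text \<open>
  A vector indexed by \<open>{..<M}\<close> is extended beyond \<open>M\<close> by \<open>v (i + M) = cis \<xi> * v i\<close>; the shift by \<open>r\<close>
  is unitary, and \<open>shift_entry\<close> is its matrix.
\<close>

definition quasi_shift :: "nat \<Rightarrow> real \<Rightarrow> nat \<Rightarrow> (nat \<Rightarrow> complex) \<Rightarrow> nat \<Rightarrow> complex" where
  "quasi_shift M \<xi> r v i = (if i + r < M then v (i + r) else cis \<xi> * v (i + r - M))"

definition shift_entry :: "nat \<Rightarrow> real \<Rightarrow> nat \<Rightarrow> nat \<Rightarrow> nat \<Rightarrow> complex" where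
  "shift_entry M \<xi> r i j = (if j = i + r then 1 else if j + M = i + r then cis \<xi> else 0)"

definition diff_energy :: "nat \<Rightarrow> real \<Rightarrow> nat \<Rightarrow> (nat \<Rightarrow> complex) \<Rightarrow> real" where
  "diff_energy M \<xi> r v = (\<Sum>i<M. (cmod (quasi_shift M \<xi> r v i - v i))\<^sup>2)"

lemma lattice_symbol_carrier [simp]: "lattice_symbol M \<kappa>\<^sub>1 \<kappa>\<^sub>2 \<xi> \<in> carrier_mat M M"
  by (simp add: lattice_symbol_def diag_block_def subdiag_block_def)

text \<open>The bonds of length \<open>r\<close> contribute \<open>2 - S - S^*\<close> with
  \<open>S\<close> the quasi-periodic shift by \<open>r\<close>; the off-diagonal blocks supply the
  entries of \<open>S\<close> and its adjoint that wrap around. Indicators are added, not nested, so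
  that coinciding positions for small \<open>M\<close> are counted correctly.\<close>

lemma lattice_symbol_index:
  assumes "2 \<le> M" "i < M" "j < M"
  shows "lattice_symbol M \<kappa>\<^sub>1 \<kappa>\<^sub>2 \<xi> $$ (i, j) =
    of_real \<kappa>\<^sub>1 * (2 * of_bool (i = j) - shift_entry M \<xi> 1 i j - cnj (shift_entry M \<xi> 1 j i)) +
    of_real \<kappa>\<^sub>2 * (2 * of_bool (i = j) - shift_entry M \<xi> 2 i j - cnj (shift_entry M \<xi> 2 j i))"
proof -
  have diag: "diag_block M \<kappa>\<^sub>1 \<kappa>\<^sub>2 $$ (i, j) =
      of_real \<kappa>\<^sub>1 * (2 * of_bool (i = j) - of_bool (j = i + 1) - of_bool (i = j + 1)) +
      of_real \<kappa>\<^sub>2 * (2 * of_bool (i = j) - of_bool (j = i + 2) - of_bool (i = j + 2))"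
  proof -
    have "\<bar>int i - int j\<bar> = 1 \<longleftrightarrow> j = i + 1 \<or> i = j + 1" "\<bar>int i - int j\<bar> = 2 \<longleftrightarrow> j = i + 2 \<or> i = j + 2"
      by linarith+
    then show ?thesis using assms by (auto simp: diag_block_def)
  qed
  \<comment> \<open>The bounds on \<open>a\<close> and \<open>b\<close> make the additive conditions
    equivalent to the corner positions, which removes the truncated subtractions.\<close>
  have sub: "subdiag_block M \<kappa>\<^sub>1 \<kappa>\<^sub>2 $$ (a, b) =
      - of_real \<kappa>\<^sub>1 * of_bool (a + M = b + 1) - of_real \<kappa>\<^sub>2 * of_bool (a + M = b + 2)"
    if "a < M" "b < M" for a b
  proof -
    have "a = 0 \<and> b = M - 1 \<longleftrightarrow> a + M = b + 1"
      "(a = 0 \<and> b = M - 2 \<or> a = 1 \<and> b = M - 1) \<longleftrightarrow> a + M = b + 2"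
      using that assms(1) by linarith+
    then show ?thesis using that by (auto simp: subdiag_block_def)
  qed
  \<comment> \<open>The two nonzero cases exclude each other because \<open>M\<close> is
    positive.\<close>
  have shift: "shift_entry M \<xi> r a b = of_bool (b = a + r) + cis \<xi> * of_bool (b + M = a + r)" for r a b
    using assms(1) by (auto simp: shift_entry_def)
  have "lattice_symbol M \<kappa>\<^sub>1 \<kappa>\<^sub>2 \<xi> $$ (i, j) = diag_block M \<kappa>\<^sub>1 \<kappa>\<^sub>2 $$ (i, j)
      + cis (- \<xi>) * subdiag_block M \<kappa>\<^sub>1 \<kappa>\<^sub>2 $$ (i, j) + cis \<xi> * subdiag_block M \<kappa>\<^sub>1 \<kappa>\<^sub>2 $$ (j, i)"
    using assms by (simp add: lattice_symbol_def diag_block_def subdiag_block_def)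
  moreover have "cnj (of_bool p) = of_bool p" for p by simp
  ultimately show ?thesis
    unfolding diag sub[OF assms(2,3)] sub[OF assms(3,2)] shift
    by (simp only: complex_cnj_add complex_cnj_mult cis_cnj) (simp only: algebra_simps mult_minus_left mult_minus_right add_uminus_conv_diff)
qed

lemma mat_adjoint_lattice_symbol:
  assumes "2 \<le> M"
  shows "mat_adjoint (lattice_symbol M \<kappa>\<^sub>1 \<kappa>\<^sub>2 \<xi>) = lattice_symbol M \<kappa>\<^sub>1 \<kappa>\<^sub>2 \<xi>"
proof (rule eq_matI)
  note c = lattice_symbol_carrier[of M \<kappa>\<^sub>1 \<kappa>\<^sub>2 \<xi>]
  fix i j assume "i < dim_row (lattice_symbol M \<kappa>\<^sub>1 \<kappa>\<^sub>2 \<xi>)" "j < dim_col (lattice_symbol M \<kappa>\<^sub>1 \<kappa>\<^sub>2 \<xi>)"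
  then have ij: "i < M" "j < M" using c by (metis carrier_matD)+
  show "mat_adjoint (lattice_symbol M \<kappa>\<^sub>1 \<kappa>\<^sub>2 \<xi>) $$ (i, j) = lattice_symbol M \<kappa>\<^sub>1 \<kappa>\<^sub>2 \<xi> $$ (i, j)"
    unfolding mat_adjoint_index[OF c ij]
    by (simp add: lattice_symbol_index assms ij eq_commute[of j i] algebra_simps)
qed (use mat_adjoint_carrier[OF lattice_symbol_carrier] lattice_symbol_carrier in \<open>metis carrier_matD\<close>)+

text \<open>Row \<open>i\<close> of the shift has a single nonzero entry, in column
  \<open>k\<close>; the bound \<open>r \<le> M\<close> keeps that column inside the block.\<close>

lemma sum_shift_entry:
  assumes "i < M" "r \<le> M"
  shows "(\<Sum>j<M. shift_entry M \<xi> r i j * v j) = quasi_shift M \<xi> r v i"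
proof -
  define k where "k = (if i + r < M then i + r else i + r - M)"
  have "k < M" using assms by (auto simp: k_def)
  have "(\<Sum>j<M. shift_entry M \<xi> r i j * v j) = (\<Sum>j<M. if j = k then quasi_shift M \<xi> r v i else 0)"
    using assms by (intro sum.cong refl) (auto simp: shift_entry_def quasi_shift_def k_def)
  then show ?thesis using \<open>k < M\<close> by simp
qed

text \<open>The index map is rotation by \<open>r\<close> modulo \<open>M\<close>, and the phase
  \<open>cis \<xi>\<close> has modulus one.\<close>

lemma sum_norm_quasi_shift:
  assumes "r \<le> M"
  shows "(\<Sum>i<M. (cmod (quasi_shift M \<xi> r v i))\<^sup>2) = (\<Sum>i<M. (cmod (v i))\<^sup>2)"
  by (rule sum.reindex_bij_witness[of _ "\<lambda>j. if r \<le> j then j - r else j + M - r"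
        "\<lambda>i. if i + r < M then i + r else i + r - M"])
    (use assms in \<open>auto simp: quasi_shift_def norm_mult\<close>)

text \<open>With \<open>S\<close> the shift, expanding the squared norm of \<open>S v - v\<close>
  gives the squared norms of \<open>S v\<close> and \<open>v\<close> minus the two cross terms.
  Unitarity makes the squared norms equal, leaving the form of \<open>2 - S - S^*\<close>.\<close>

lemma shift_form_eq_diff_energy:
  assumes "r \<le> M"
  shows "(\<Sum>i<M. \<Sum>j<M. (2 * of_bool (i = j) - shift_entry M \<xi> r i j - cnj (shift_entry M \<xi> r j i))
            * v j * cnj (v i)) = of_real (diff_energy M \<xi> r v)"
proof -
  let ?s = "quasi_shift M \<xi> r v"
  have "(\<Sum>i<M. \<Sum>j<M. (2 * of_bool (i = j) - shift_entry M \<xi> r i j - cnj (shift_entry M \<xi> r j i))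
            * v j * cnj (v i)) =
      2 * (\<Sum>i<M. \<Sum>j<M. of_bool (i = j) * v j * cnj (v i))
      - (\<Sum>i<M. \<Sum>j<M. shift_entry M \<xi> r i j * v j * cnj (v i))
      - (\<Sum>i<M. \<Sum>j<M. cnj (shift_entry M \<xi> r j i) * v j * cnj (v i))"
    by (simp add: algebra_simps sum.distrib sum_subtractf sum_distrib_left)
  also have "(\<Sum>i<M. \<Sum>j<M. of_bool (i = j) * v j * cnj (v i)) = (\<Sum>i<M. v i * cnj (v i))"
  proof (intro sum.cong refl)
    fix i assume "i \<in> {..<M}"
    have "(\<Sum>j<M. of_bool (i = j) * v j * cnj (v i)) = (\<Sum>j<M. if i = j then v i * cnj (v i) else 0)"
      by (intro sum.cong) auto
    then show "(\<Sum>j<M. of_bool (i = j) * v j * cnj (v i)) = v i * cnj (v i)"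
      using \<open>i \<in> {..<M}\<close> by simp
  qed
  also have "(\<Sum>i<M. \<Sum>j<M. shift_entry M \<xi> r i j * v j * cnj (v i)) = (\<Sum>i<M. ?s i * cnj (v i))"
    using assms by (intro sum.cong refl) (simp add: sum_distrib_right[symmetric] sum_shift_entry)
  \<comment> \<open>After exchanging the sums, the inner one is the conjugate of row
    \<open>j\<close> of the shift applied to \<open>v\<close>.\<close>
  also have "(\<Sum>i<M. \<Sum>j<M. cnj (shift_entry M \<xi> r j i) * v j * cnj (v i)) = (\<Sum>j<M. v j * cnj (?s j))"
  proof (subst sum.swap, intro sum.cong refl)
    fix j assume j: "j \<in> {..<M}"
    have "(\<Sum>i<M. cnj (shift_entry M \<xi> r j i) * v j * cnj (v i)) =
        v j * cnj (\<Sum>i<M. shift_entry M \<xi> r j i * v i)"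
      by (simp add: sum_distrib_left mult_ac)
    then show "(\<Sum>i<M. cnj (shift_entry M \<xi> r j i) * v j * cnj (v i)) = v j * cnj (?s j)"
      using j assms sum_shift_entry[of j M r \<xi> v] by (simp only: lessThan_iff)
  qed
  finally have 1: "(\<Sum>i<M. \<Sum>j<M. (2 * of_bool (i = j) - shift_entry M \<xi> r i j - cnj (shift_entry M \<xi> r j i))
            * v j * cnj (v i)) =
      2 * (\<Sum>i<M. v i * cnj (v i)) - (\<Sum>i<M. ?s i * cnj (v i)) - (\<Sum>j<M. v j * cnj (?s j))" .
  have "of_real (\<Sum>i<M. (cmod (?s i))\<^sup>2) = (of_real (\<Sum>i<M. (cmod (v i))\<^sup>2) :: complex)"
    using sum_norm_quasi_shift[OF assms] by simp
  then have 2: "(\<Sum>i<M. ?s i * cnj (?s i)) = (\<Sum>i<M. v i * cnj (v i))"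
    by (simp only: of_real_sum complex_norm_square)
  have "complex_of_real (diff_energy M \<xi> r v) = (\<Sum>i<M. (?s i - v i) * cnj (?s i - v i))"
    unfolding diff_energy_def by (simp only: of_real_sum complex_norm_square)
  also have "\<dots> = (\<Sum>i<M. ?s i * cnj (?s i)) + (\<Sum>i<M. v i * cnj (v i))
      - (\<Sum>i<M. ?s i * cnj (v i)) - (\<Sum>j<M. v j * cnj (?s j))"
    by (simp add: algebra_simps sum.distrib sum_subtractf)
  finally show ?thesis using 1 2 by simp
qed

lemma lattice_symbol_form:
  assumes "2 \<le> M" and v: "v \<in> carrier_vec M"
  shows "(lattice_symbol M \<kappa>\<^sub>1 \<kappa>\<^sub>2 \<xi> *\<^sub>v v) \<bullet>c v =
    of_real (\<kappa>\<^sub>1 * diff_energy M \<xi> 1 (($) v) + \<kappa>\<^sub>2 * diff_energy M \<xi> 2 (($) v))"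
proof -
  let ?e = "\<lambda>r i j. 2 * of_bool (i = j) - shift_entry M \<xi> r i j - cnj (shift_entry M \<xi> r j i)"
  have "(lattice_symbol M \<kappa>\<^sub>1 \<kappa>\<^sub>2 \<xi> *\<^sub>v v) \<bullet>c v
      = (\<Sum>i<M. \<Sum>j<M. lattice_symbol M \<kappa>\<^sub>1 \<kappa>\<^sub>2 \<xi> $$ (i, j) * v $ j * cnj (v $ i))"
    unfolding cscalar_prod_sum[OF v]
    by (intro sum.cong refl)
      (simp add: mult_mat_vec_index_sum[OF lattice_symbol_carrier v] sum_distrib_right)
  also have "\<dots> = (\<Sum>i<M. \<Sum>j<M. of_real \<kappa>\<^sub>1 * (?e 1 i j * v $ j * cnj (v $ i))
      + of_real \<kappa>\<^sub>2 * (?e 2 i j * v $ j * cnj (v $ i)))"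
    using assms(1) by (intro sum.cong refl) (simp add: lattice_symbol_index ring_distribs)
  also have "\<dots> = of_real \<kappa>\<^sub>1 * (\<Sum>i<M. \<Sum>j<M. ?e 1 i j * v $ j * cnj (v $ i))
      + of_real \<kappa>\<^sub>2 * (\<Sum>i<M. \<Sum>j<M. ?e 2 i j * v $ j * cnj (v $ i))"
    by (simp only: sum.distrib sum_distrib_left)
  also have "\<dots> = of_real (\<kappa>\<^sub>1 * diff_energy M \<xi> 1 (($) v) + \<kappa>\<^sub>2 * diff_energy M \<xi> 2 (($) v))"
    using assms(1) by (simp only: shift_form_eq_diff_energy) simp
  finally show ?thesis .
qed

section \<open>Positivity of the quadratic form\<close>

lemma diff_energy_nonneg: "0 \<le> diff_energy M \<xi> r v"
  unfolding diff_energy_def by (intro sum_nonneg) simp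

lemma cmod_add_sq_le: "(cmod (a + b))\<^sup>2 \<le> 2 * (cmod a)\<^sup>2 + 2 * (cmod b)\<^sup>2"
proof -
  have "(cmod (a + b))\<^sup>2 \<le> (cmod a + cmod b)\<^sup>2" by (intro power_mono norm_triangle_ineq) simp
  also have "\<dots> \<le> 2 * (cmod a)\<^sup>2 + 2 * (cmod b)\<^sup>2"
    using zero_le_power2[of "cmod a - cmod b"] by (simp add: power2_eq_square algebra_simps)
  finally show ?thesis .
qed

text \<open>With \<open>S\<close> the shift by one and \<open>d = S v - v\<close>, the difference at
  distance two is \<open>S d + d\<close>. The factor \<open>4\<close> comes from the inequality for
  the square of a sum and from \<open>S d\<close> having the same norm as \<open>d\<close>.\<close>

lemma diff_energy_2_le:
  assumes "2 \<le> M"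
  shows "diff_energy M \<xi> 2 v \<le> 4 * diff_energy M \<xi> 1 v"
proof -
  define d where "d i = quasi_shift M \<xi> 1 v i - v i" for i
  have "quasi_shift M \<xi> 2 v i - v i = quasi_shift M \<xi> 1 d i + d i" if "i < M" for i
  proof -
    \<comment> \<open>Neither step leaves the block, only the second does, or the first does; in the
      last case \<open>M \<ge> 2\<close> prevents wrapping twice.\<close>
    consider "i + 2 < M" | "i + 2 = M" | "i + 1 = M" using \<open>i < M\<close> by linarith
    then show ?thesis
      using assms by cases (auto simp: quasi_shift_def d_def algebra_simps)
  qed
  then have "diff_energy M \<xi> 2 v = (\<Sum>i<M. (cmod (quasi_shift M \<xi> 1 d i + d i))\<^sup>2)"
    unfolding diff_energy_def by (intro sum.cong) auto
  also have "\<dots> \<le> (\<Sum>i<M. 2 * (cmod (quasi_shift M \<xi> 1 d i))\<^sup>2 + 2 * (cmod (d i))\<^sup>2)"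
    by (intro sum_mono cmod_add_sq_le)
  also have "\<dots> = 4 * (\<Sum>i<M. (cmod (d i))\<^sup>2)"
    using assms by (simp add: sum.distrib sum_distrib_left[symmetric] sum_norm_quasi_shift)
  finally show ?thesis by (simp add: diff_energy_def d_def)
qed

text \<open>The two arguments of \<open>min\<close> are the two signs of
  \<open>\<kappa>\<^sub>2\<close>: for a nonnegative one the second energy is dropped, for a
  negative one it is replaced by its upper bound.\<close>

lemma energy_lower_bound:
  assumes "2 \<le> M"
  shows "min \<kappa>\<^sub>1 (\<kappa>\<^sub>1 + 4 * \<kappa>\<^sub>2) * diff_energy M \<xi> 1 v
    \<le> \<kappa>\<^sub>1 * diff_energy M \<xi> 1 v + \<kappa>\<^sub>2 * diff_energy M \<xi> 2 v"
proof (cases "0 \<le> \<kappa>\<^sub>2")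
  case True
  then show ?thesis using diff_energy_nonneg[of M \<xi> 2 v] by (simp add: min_def)
next
  case False
  then have "\<kappa>\<^sub>2 * (4 * diff_energy M \<xi> 1 v) \<le> \<kappa>\<^sub>2 * diff_energy M \<xi> 2 v"
    using diff_energy_2_le[OF assms] by (intro mult_left_mono_neg) auto
  then show ?thesis using False by (simp add: min_def algebra_simps)
qed

lemma lattice_symbol_psd:
  assumes "2 \<le> M" "0 < \<kappa>\<^sub>1" "0 < \<kappa>\<^sub>1 + 4 * \<kappa>\<^sub>2" and v: "v \<in> carrier_vec M"
  shows "\<exists>r\<ge>0. (lattice_symbol M \<kappa>\<^sub>1 \<kappa>\<^sub>2 \<xi> *\<^sub>v v) \<bullet>c v = complex_of_real r"
proof -
  have "0 \<le> min \<kappa>\<^sub>1 (\<kappa>\<^sub>1 + 4 * \<kappa>\<^sub>2) * diff_energy M \<xi> 1 (($) v)"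
    using assms(2,3) diff_energy_nonneg by (intro mult_nonneg_nonneg) auto
  also note energy_lower_bound[OF assms(1)]
  finally show ?thesis using lattice_symbol_form[OF assms(1) v] by blast
qed

text \<open>The coefficient in \<open>energy_lower_bound\<close> is positive, so the
  nearest-neighbor energy vanishes and with it every single difference. Differences inside the block
  make \<open>v\<close> constant; the wrapped one, at \<open>M - 1\<close>, gives the phase
  condition.\<close>

lemma lattice_symbol_kernel:
  assumes "2 \<le> M" "0 < \<kappa>\<^sub>1" "0 < \<kappa>\<^sub>1 + 4 * \<kappa>\<^sub>2" and v: "v \<in> carrier_vec M"
    and 0: "(lattice_symbol M \<kappa>\<^sub>1 \<kappa>\<^sub>2 \<xi> *\<^sub>v v) \<bullet>c v = 0"
  shows "\<And>i. i < M \<Longrightarrow> v $ i = v $ 0" and "cis \<xi> * v $ 0 = v $ 0"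
proof -
  have "min \<kappa>\<^sub>1 (\<kappa>\<^sub>1 + 4 * \<kappa>\<^sub>2) * diff_energy M \<xi> 1 (($) v) \<le> 0"
    using 0 energy_lower_bound[OF assms(1), of \<kappa>\<^sub>1 \<kappa>\<^sub>2 \<xi> "($) v"]
    unfolding lattice_symbol_form[OF assms(1) v] of_real_eq_0_iff by simp
  moreover have "0 < min \<kappa>\<^sub>1 (\<kappa>\<^sub>1 + 4 * \<kappa>\<^sub>2)" using assms by simp
  ultimately have "diff_energy M \<xi> 1 (($) v) \<le> 0" by (meson mult_pos_pos not_le)
  then have "diff_energy M \<xi> 1 (($) v) = 0" using diff_energy_nonneg by (intro antisym)
  then have step: "quasi_shift M \<xi> 1 (($) v) i = v $ i" if "i < M" for i
    using that by (simp add: diff_energy_def sum_nonneg_eq_0_iff)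
  show const: "v $ i = v $ 0" if "i < M" for i
    using that
  proof (induction i)
    case (Suc i)
    then show ?case using step[of i] by (simp add: quasi_shift_def)
  qed simp
  show "cis \<xi> * v $ 0 = v $ 0"
    using step[of "M - 1"] const[of "M - 1"] assms(1) by (simp add: quasi_shift_def)
qed

section \<open>The energy of the hat functions\<close>

lemma hat_norm_pos: "2 \<le> M \<Longrightarrow> 0 < hat_norm M"
  by (simp add: hat_norm_def add_pos_pos)

lemma hat_norm_sq: "(hat_norm M)\<^sup>2 = real M * (2 * (real M)\<^sup>2 + 1) / 3"
  by (simp add: hat_norm_def power3_eq_cube power2_eq_square algebra_simps)

lemma hat_symbol_carrier [simp]: "hat_symbol M \<xi> \<in> carrier_vec M"
  by (simp add: hat_symbol_def hat_rising_def hat_falling_def)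

lemma hat_symbol_index:
  assumes "i < M"
  shows "hat_symbol M \<xi> $ i =
    (of_nat (i + 1) + cis (- \<xi>) * (of_nat M - of_nat (i + 1))) / of_real (hat_norm M)"
  using assms by (simp add: hat_symbol_def hat_rising_def hat_falling_def add_divide_distrib)

lemma hat_symbol_self_prod:
  assumes "2 \<le> M"
  shows "hat_symbol M \<xi> \<bullet>c hat_symbol M \<xi> \<noteq> 0"
proof
  assume "hat_symbol M \<xi> \<bullet>c hat_symbol M \<xi> = 0"
  then have "hat_symbol M \<xi> = 0\<^sub>v M" by (simp only: conjugate_square_eq_0_vec[OF hat_symbol_carrier])
  \<comment> \<open>At the last site the falling part vanishes, so this component equals
    \<open>M / hat_norm M\<close> for every \<xi>.\<close>
  then have "hat_symbol M \<xi> $ (M - 1) = 0" using assms by simp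
  then show False using assms hat_norm_pos[OF assms] by (simp add: hat_symbol_index)
qed

lemma norm_diff_cis_sq: "(cmod (1 - cis \<xi>))\<^sup>2 = 2 - 2 * cos \<xi>"
proof -
  have "(cmod (1 - cis \<xi>))\<^sup>2 = (1 - cos \<xi>)\<^sup>2 + (sin \<xi>)\<^sup>2" by (simp add: cmod_power2)
  then show ?thesis using sin_cos_squared_add[of \<xi>] by (simp add: power2_diff)
qed

text \<open>The quasi-periodic extension of the hat symbol is linear from one peak to the next.
  Inside the block the slope is \<open>1 - cis (- \<xi>)\<close>, across the boundary it is
  \<open>cis \<xi> - 1\<close>, both over the norm and of equal modulus.\<close>

lemma diff_energy_hat_1:
  assumes "2 \<le> M"
  shows "diff_energy M \<xi> 1 (($) (hat_symbol M \<xi>)) = real M * (2 - 2 * cos \<xi>) / (hat_norm M)\<^sup>2"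
proof -
  have "(cmod (quasi_shift M \<xi> 1 (($) (hat_symbol M \<xi>)) i - hat_symbol M \<xi> $ i))\<^sup>2
      = (2 - 2 * cos \<xi>) / (hat_norm M)\<^sup>2" if "i < M" for i
  proof (cases "i + 1 < M")
    case True
    then have "quasi_shift M \<xi> 1 (($) (hat_symbol M \<xi>)) i - hat_symbol M \<xi> $ i
        = (1 - cis (- \<xi>)) / of_real (hat_norm M)"
      by (simp add: quasi_shift_def hat_symbol_index diff_divide_distrib[symmetric] algebra_simps)
    then show ?thesis using norm_diff_cis_sq[of "- \<xi>"] by (simp add: norm_divide power_divide)
  next
    case False
    with \<open>i < M\<close> have M: "M = Suc i" by simp
    then have "quasi_shift M \<xi> 1 (($) (hat_symbol M \<xi>)) i - hat_symbol M \<xi> $ i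
        = - ((1 - cis \<xi>) / of_real (hat_norm M))"
      using cis_mult[of \<xi> "- \<xi>"]
      by (simp add: quasi_shift_def hat_symbol_index diff_divide_distrib[symmetric]
            minus_divide_left algebra_simps)
    then show ?thesis using norm_diff_cis_sq[of \<xi>] by (simp add: norm_divide power_divide)
  qed
  then show ?thesis by (simp add: diff_energy_def)
qed

text \<open>A difference at distance two doubles the slope, except the one starting at
  \<open>M - 2\<close>, which straddles the kink at site \<open>M - 1\<close>. There the two slopes
  add up to \<open>cis \<xi> - cis (- \<xi>)\<close>, the source of the sine term.\<close>

lemma diff_energy_hat_2:
  assumes "2 \<le> M"
  shows "diff_energy M \<xi> 2 (($) (hat_symbol M \<xi>)) =
    (4 * (real M - 1) * (2 - 2 * cos \<xi>) + 4 * (sin \<xi>)\<^sup>2) / (hat_norm M)\<^sup>2"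
proof -
  define c where "c = hat_norm M"
  define h where "h = ($) (hat_symbol M \<xi>)"
  obtain m where M: "M = Suc (Suc m)" using assms that[of "M - 2"] by simp
  have cis: "cis \<xi> * (cis (- \<xi>) * z) = z" "cis \<xi> * cis (- \<xi>) = 1" for z
    by (simp_all add: mult.assoc[symmetric] cis_mult)
  have norm: "(cmod (2 * (1 - cis t) / of_real c))\<^sup>2 = 4 * (2 - 2 * cos t) / c\<^sup>2" for t
    by (simp only: norm_divide norm_mult power_divide power_mult_distrib norm_diff_cis_sq) simp
  have "quasi_shift M \<xi> 2 h i - h i = 2 * (1 - cis (- \<xi>)) / of_real c" if "i < m" for i
    using that by (simp add: quasi_shift_def M h_def c_def hat_symbol_index diff_divide_distrib[symmetric] algebra_simps)
  then have 1: "(cmod (quasi_shift M \<xi> 2 h i - h i))\<^sup>2 = 4 * (2 - 2 * cos \<xi>) / c\<^sup>2" if "i < m" for i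
    using that norm[of "- \<xi>"] by (simp only: cos_minus)
  have "quasi_shift M \<xi> 2 h m - h m = (cis \<xi> - cis (- \<xi>)) / of_real c"
    by (simp add: quasi_shift_def M h_def c_def hat_symbol_index diff_divide_distrib[symmetric] algebra_simps cis)
  moreover have "cis \<xi> - cis (- \<xi>) = 2 * \<i> * of_real (sin \<xi>)" by (simp add: complex_eq_iff)
  ultimately have 2: "(cmod (quasi_shift M \<xi> 2 h m - h m))\<^sup>2 = 4 * (sin \<xi>)\<^sup>2 / c\<^sup>2"
    by (simp add: norm_divide norm_mult power_divide power_mult_distrib)
  have "quasi_shift M \<xi> 2 h (Suc m) - h (Suc m) = - (2 * (1 - cis \<xi>) / of_real c)"
    by (simp add: quasi_shift_def M h_def c_def hat_symbol_index diff_divide_distrib[symmetric]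
          minus_divide_left algebra_simps cis)
  then have 3: "(cmod (quasi_shift M \<xi> 2 h (Suc m) - h (Suc m)))\<^sup>2 = 4 * (2 - 2 * cos \<xi>) / c\<^sup>2"
    using norm[of \<xi>] by (simp only: norm_minus_cancel)
  have "diff_energy M \<xi> 2 h = (\<Sum>i<m. 4 * (2 - 2 * cos \<xi>) / c\<^sup>2) + 4 * (sin \<xi>)\<^sup>2 / c\<^sup>2 + 4 * (2 - 2 * cos \<xi>) / c\<^sup>2"
    unfolding diff_energy_def M lessThan_Suc using 1 2 3 M by simp
  then show ?thesis by (simp add: M h_def c_def add_divide_distrib[symmetric] algebra_simps)
qed

definition hat_energy :: "nat \<Rightarrow> real \<Rightarrow> real \<Rightarrow> real \<Rightarrow> real" where
  "hat_energy M \<kappa>\<^sub>1 \<kappa>\<^sub>2 \<xi> = (\<kappa>\<^sub>1 * (real M * (2 - 2 * cos \<xi>))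
     + \<kappa>\<^sub>2 * (4 * (real M - 1) * (2 - 2 * cos \<xi>) + 4 * (sin \<xi>)\<^sup>2)) / (hat_norm M)\<^sup>2"

lemma lattice_symbol_hat_form:
  assumes "2 \<le> M"
  shows "(lattice_symbol M \<kappa>\<^sub>1 \<kappa>\<^sub>2 \<xi> *\<^sub>v hat_symbol M \<xi>) \<bullet>c hat_symbol M \<xi>
    = of_real (hat_energy M \<kappa>\<^sub>1 \<kappa>\<^sub>2 \<xi>)"
  unfolding lattice_symbol_form[OF assms hat_symbol_carrier] hat_energy_def
  by (simp only: diff_energy_hat_1[OF assms] diff_energy_hat_2[OF assms] times_divide_eq_right add_divide_distrib
      distrib_left)

text \<open>Over a period \<open>2 - 2 * cos \<xi>\<close> and
  \<open>4 * (sin \<xi>)\<^sup>2\<close> both have mean \<open>2\<close>, so the coefficient of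
  \<open>\<kappa>\<^sub>2\<close> is \<open>8 * (M - 1) + 2 = 8 * M - 6\<close>.\<close>

lemma hat_energy_has_integral:
  "(hat_energy M \<kappa>\<^sub>1 \<kappa>\<^sub>2 has_integral
      2 * pi * ((2 * real M * \<kappa>\<^sub>1 + 8 * real M * \<kappa>\<^sub>2 - 6 * \<kappa>\<^sub>2) / (hat_norm M)\<^sup>2)) {0..2 * pi}"
proof -
  define G where "G \<xi> = \<kappa>\<^sub>1 * (real M * (2 * \<xi> - 2 * sin \<xi>))
     + \<kappa>\<^sub>2 * (4 * (real M - 1) * (2 * \<xi> - 2 * sin \<xi>) + 2 * (\<xi> - sin \<xi> * cos \<xi>))" for \<xi>
  define F where "F \<xi> = G \<xi> / (hat_norm M)\<^sup>2" for \<xi>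
  have "(F has_real_derivative hat_energy M \<kappa>\<^sub>1 \<kappa>\<^sub>2 \<xi>) (at \<xi> within {0..2 * pi})" for \<xi>
  proof -
    have sin_sq: "4 * (sin \<xi>)\<^sup>2 = 2 * (1 - (cos \<xi> * cos \<xi> - sin \<xi> * sin \<xi>))"
      using sin_cos_squared_add[of \<xi>] by (simp add: power2_eq_square)
    have "(G has_real_derivative \<kappa>\<^sub>1 * (real M * (2 - 2 * cos \<xi>))
        + \<kappa>\<^sub>2 * (4 * (real M - 1) * (2 - 2 * cos \<xi>) + 4 * (sin \<xi>)\<^sup>2)) (at \<xi> within {0..2 * pi})"
      unfolding G_def sin_sq by (auto intro!: derivative_eq_intros simp: algebra_simps)
    then show ?thesis unfolding F_def hat_energy_def by (rule DERIV_cdivide)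
  qed
  then have "(hat_energy M \<kappa>\<^sub>1 \<kappa>\<^sub>2 has_integral F (2 * pi) - F 0) {0..2 * pi}"
    by (intro fundamental_theorem_of_calculus)
      (auto simp: has_real_derivative_iff_has_vector_derivative[symmetric])
  moreover have "F (2 * pi) - F 0 =
      2 * pi * ((2 * real M * \<kappa>\<^sub>1 + 8 * real M * \<kappa>\<^sub>2 - 6 * \<kappa>\<^sub>2) / (hat_norm M)\<^sup>2)"
    by (simp add: F_def G_def diff_divide_distrib[symmetric] algebra_simps)
  ultimately show ?thesis by simp
qed

section \<open>Definiteness over one period\<close>

lemma cis_eq_1_in_period:
  assumes "\<xi> \<in> {0<..2 * pi}" "cis \<xi> = 1"
  shows "\<xi> = 2 * pi"
proof -
  have "cos \<xi> = 1" using assms(2) by (metis cis.simps(1) one_complex.simps(1))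
  then obtain k :: int where k: "\<xi> = k * (2 * pi)" by (auto simp: cos_one_2pi_int)
  have "0 < k" using assms(1) k by (simp add: zero_less_mult_iff)
  moreover have "k \<le> 1" using assms(1) k by (simp add: mult_le_cancel_right1)
  ultimately show ?thesis using k by simp
qed

text \<open>A null vector is constant, and for \<open>\<xi> < 2 * pi\<close> the phase condition
  makes it zero. At \<open>2 * pi\<close> constants are annihilated by the symbol, and only
  orthogonality to the hat symbol excludes them. The alternative in \<open>side\<close> thus serves
  both the symbol itself and its compression.\<close>

lemma lattice_symbol_definite:
  assumes "2 \<le> M" "0 < \<kappa>\<^sub>1" "0 < \<kappa>\<^sub>1 + 4 * \<kappa>\<^sub>2" "\<xi> \<in> {0<..2 * pi}"
    and v: "v \<in> carrier_vec M"
    and side: "\<xi> < 2 * pi \<or> v \<in> orth_compl M (hat_symbol M \<xi>)"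
    and 0: "(lattice_symbol M \<kappa>\<^sub>1 \<kappa>\<^sub>2 \<xi> *\<^sub>v v) \<bullet>c v = 0"
  shows "v = 0\<^sub>v M"
proof -
  note const = lattice_symbol_kernel[OF assms(1-3) v 0]
  have "v $ 0 = 0"
  proof (cases "cis \<xi> = 1")
    case True
    then have \<xi>: "\<xi> = 2 * pi" using assms(4) cis_eq_1_in_period by blast
    have one: "cis (- \<xi>) = 1" by (simp add: \<xi> complex_eq_iff)
    \<comment> \<open>At \<open>2 * pi\<close> the rising and falling parts add up to the same value
      at every site, so the hat symbol is itself a nonzero constant.\<close>
    have "v $ i * cnj (hat_symbol M \<xi> $ i) = v $ 0 * of_real (real M / hat_norm M)" if "i < M" for i
      using that const(1)[OF that] by (simp add: hat_symbol_index one)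
    moreover have "v \<bullet>c hat_symbol M \<xi> = 0" using side \<xi> by (simp add: orth_compl_def)
    ultimately have "(\<Sum>i<M. v $ 0 * of_real (real M / hat_norm M)) = 0"
      by (simp add: cscalar_prod_sum[OF hat_symbol_carrier])
    then show ?thesis using hat_norm_pos[OF assms(1)] assms(1) by simp
  qed (use const(2) in simp)
  then have "v $ i = 0" if "i < M" for i using const(1)[OF that] by simp
  then show ?thesis using v by (intro eq_vecI) auto
qed

section \<open>Continuity and integration\<close>

text \<open>The Leibniz formula is a polynomial in the entries.\<close>

lemma continuous_on_det:
  fixes F :: "real \<Rightarrow> complex mat"
  assumes "\<And>t. t \<in> S \<Longrightarrow> F t \<in> carrier_mat n n"
    and "\<And>i j. i < n \<Longrightarrow> j < n \<Longrightarrow> continuous_on S (\<lambda>t. F t $$ (i, j))"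
  shows "continuous_on S (\<lambda>t. Determinant.det (F t))"
proof -
  have "continuous_on S (\<lambda>t. \<Sum>p | p permutes {0..<n}. signof p * (\<Prod>i = 0..<n. F t $$ (i, p i)))"
    using assms(2) by (intro continuous_intros) (auto simp: permutes_in_image)
  then show ?thesis
    by (rule continuous_on_eq) (simp add: det_def'[OF assms(1)])
qed

text \<open>Entries of the adjugate are signed minors, to which \<open>continuous_on_det\<close>
  applies.\<close>

lemma continuous_on_adj_mat:
  fixes F :: "real \<Rightarrow> complex mat"
  assumes F: "\<And>t. t \<in> S \<Longrightarrow> F t \<in> carrier_mat n n"
    and cont: "\<And>i j. i < n \<Longrightarrow> j < n \<Longrightarrow> continuous_on S (\<lambda>t. F t $$ (i, j))"
    and ij: "i < n" "j < n"
  shows "continuous_on S (\<lambda>t. adj_mat (F t) $$ (i, j))"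
proof -
  have "continuous_on S (\<lambda>t. Determinant.det (mat_delete (F t) j i))"
  proof (rule continuous_on_det[of _ _ "n - 1"])
    fix k l assume kl: "k < n - 1" "l < n - 1"
    have "continuous_on S (\<lambda>t. F t $$ (if k < j then k else Suc k, if l < i then l else Suc l))"
      using kl by (intro cont) auto
    moreover have "mat_delete (F t) j i $$ (k, l) = F t $$ (if k < j then k else Suc k, if l < i then l else Suc l)"
      if "t \<in> S" for t
      using F[OF that] kl by (simp add: mat_delete_def)
    ultimately show "continuous_on S (\<lambda>t. mat_delete (F t) j i $$ (k, l))"
      by (simp cong: continuous_on_cong)
  qed (use F mat_delete_carrier in blast)
  then have "continuous_on S (\<lambda>t. (- 1) ^ (j + i) * Determinant.det (mat_delete (F t) j i))"
    by (intro continuous_intros)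
  moreover have "adj_mat (F t) $$ (i, j) = (- 1) ^ (j + i) * Determinant.det (mat_delete (F t) j i)" if "t \<in> S" for t
    using F[OF that] ij by (simp add: adj_mat_def cofactor_def)
  ultimately show ?thesis by (simp cong: continuous_on_cong)
qed

text \<open>Cramer's rule gives a solution whose continuous dependence on the matrix entries is
  visible.\<close>

lemma adj_mat_solves:
  fixes A :: "'a :: field mat"
  assumes A: "A \<in> carrier_mat n n" and b: "b \<in> carrier_vec n" and det: "Determinant.det A \<noteq> 0"
  shows "A *\<^sub>v ((1 / Determinant.det A) \<cdot>\<^sub>v (adj_mat A *\<^sub>v b)) = b"
proof -
  note adj = adj_mat[OF A]
  have "A *\<^sub>v (adj_mat A *\<^sub>v b) = (Determinant.det A \<cdot>\<^sub>m 1\<^sub>m n) *\<^sub>v b"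
    using assoc_mult_mat_vec[OF A adj(1) b] adj(2) by simp
  also have "\<dots> = Determinant.det A \<cdot>\<^sub>v b" using b by auto
  finally have "A *\<^sub>v (adj_mat A *\<^sub>v b) = Determinant.det A \<cdot>\<^sub>v b" .
  then show ?thesis
    using A adj(1) b det by (simp add: mult_mat_vec[of _ n n] smult_smult_assoc)
qed

lemma continuous_on_shift_entry: "continuous_on S (\<lambda>\<xi>. shift_entry M \<xi> r i j)"
  unfolding shift_entry_def
  by (cases "j = i + r"; cases "j + M = i + r") (simp_all add: continuous_intros)

lemma continuous_on_lattice_symbol:
  assumes "2 \<le> M" "i < M" "j < M"
  shows "continuous_on S (\<lambda>\<xi>. lattice_symbol M \<kappa>\<^sub>1 \<kappa>\<^sub>2 \<xi> $$ (i, j))"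
  unfolding lattice_symbol_index[OF assms] by (intro continuous_intros continuous_on_shift_entry)

lemma continuous_on_hat_symbol:
  assumes "2 \<le> M" "i < M"
  shows "continuous_on S (\<lambda>\<xi>. hat_symbol M \<xi> $ i)"
  unfolding hat_symbol_index[OF assms(2)]
  using hat_norm_pos[OF assms(1)] by (intro continuous_intros) auto

text \<open>The compression lemmas at the lattice symbol. The first part makes the inverse in the
  integrand genuine, the second gives the estimate, and the third is a formula without
  \<open>\<Psi>\<close>, from which continuity follows.\<close>

lemma memory_integrand_bounds:
  assumes M: "2 \<le> M" and \<kappa>: "0 < \<kappa>\<^sub>1" "0 < \<kappa>\<^sub>1 + 4 * \<kappa>\<^sub>2" and \<xi>: "\<xi> \<in> {0<..2 * pi}"
    and basis: "cols_basis_orth_compl M (hat_symbol M \<xi>) (\<Psi> \<xi>)"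
  shows "invertible_mat (Omega_sq_symbol M \<kappa>\<^sub>1 \<kappa>\<^sub>2 \<Psi> \<xi>)"
    and "\<exists>r. 0 \<le> r \<and> r \<le> hat_energy M \<kappa>\<^sub>1 \<kappa>\<^sub>2 \<xi> \<and> memory_integrand M \<kappa>\<^sub>1 \<kappa>\<^sub>2 \<Psi> \<xi> = of_real r"
    and "\<And>x. x \<in> carrier_vec M \<Longrightarrow> lattice_symbol M \<kappa>\<^sub>1 \<kappa>\<^sub>2 \<xi> *\<^sub>v x = hat_symbol M \<xi> \<Longrightarrow>
      x \<bullet>c hat_symbol M \<xi> \<noteq> 0 \<and> memory_integrand M \<kappa>\<^sub>1 \<kappa>\<^sub>2 \<Psi> \<xi> = of_real (hat_energy M \<kappa>\<^sub>1 \<kappa>\<^sub>2 \<xi>)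
        - (hat_symbol M \<xi> \<bullet>c hat_symbol M \<xi>)\<^sup>2 / (x \<bullet>c hat_symbol M \<xi>)"
proof -
  let ?A = "lattice_symbol M \<kappa>\<^sub>1 \<kappa>\<^sub>2 \<xi>" and ?u = "hat_symbol M \<xi>"
  have definite: "v = 0\<^sub>v M" if "v \<in> orth_compl M ?u" "(?A *\<^sub>v v) \<bullet>c v = 0" for v
    using lattice_symbol_definite[OF M \<kappa> \<xi> _ _ that(2)] that(1) by (simp add: orth_compl_def)
  note form = compression_quadratic_form[OF lattice_symbol_carrier
      mat_adjoint_lattice_symbol[OF M, of \<kappa>\<^sub>1 \<kappa>\<^sub>2 \<xi>] hat_symbol_carrier basis]
  note psd = lattice_symbol_psd[OF M \<kappa>]
  have P: "\<Psi> \<xi> \<in> carrier_mat M (M - 1)" using cols_basis_orth_complD(1)[OF hat_symbol_carrier basis] .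
  have "Omega_sq_symbol M \<kappa>\<^sub>1 \<kappa>\<^sub>2 \<Psi> \<xi> \<in> carrier_mat (M - 1) (M - 1)"
    unfolding Omega_sq_symbol_def
    using P mat_adjoint_carrier[OF P] lattice_symbol_carrier by (intro mult_carrier_mat)
  then show "invertible_mat (Omega_sq_symbol M \<kappa>\<^sub>1 \<kappa>\<^sub>2 \<Psi> \<xi>)"
    unfolding Omega_sq_symbol_def
    by (rule invertible_matI_injective)
      (rule compression_injective[OF lattice_symbol_carrier hat_symbol_carrier basis definite])
  have "\<exists>r. 0 \<le> r \<and> r \<le> Re ((?A *\<^sub>v ?u) \<bullet>c ?u) \<and> memory_integrand M \<kappa>\<^sub>1 \<kappa>\<^sub>2 \<Psi> \<xi> = of_real r"
    unfolding memory_integrand_def Omega_sq_symbol_def by (rule form(1)) (fact psd definite)+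
  then show "\<exists>r. 0 \<le> r \<and> r \<le> hat_energy M \<kappa>\<^sub>1 \<kappa>\<^sub>2 \<xi> \<and> memory_integrand M \<kappa>\<^sub>1 \<kappa>\<^sub>2 \<Psi> \<xi> = of_real r"
    by (simp only: lattice_symbol_hat_form[OF M] Re_complex_of_real)
  fix x assume x: "x \<in> carrier_vec M" "?A *\<^sub>v x = ?u"
  show "x \<bullet>c ?u \<noteq> 0 \<and> memory_integrand M \<kappa>\<^sub>1 \<kappa>\<^sub>2 \<Psi> \<xi> = of_real (hat_energy M \<kappa>\<^sub>1 \<kappa>\<^sub>2 \<xi>)
        - (?u \<bullet>c ?u)\<^sup>2 / (x \<bullet>c ?u)"
    unfolding lattice_symbol_hat_form[OF M, symmetric] memory_integrand_def Omega_sq_symbol_def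
    by (intro form(2) hat_symbol_self_prod[OF M]) (fact psd definite x)+
qed

lemma continuous_on_memory_integrand:
  assumes M: "2 \<le> M" and \<kappa>: "0 < \<kappa>\<^sub>1" "0 < \<kappa>\<^sub>1 + 4 * \<kappa>\<^sub>2"
    and basis: "\<And>\<xi>. \<xi> \<in> {0<..2 * pi} \<Longrightarrow> cols_basis_orth_compl M (hat_symbol M \<xi>) (\<Psi> \<xi>)"
  shows "continuous_on {0<..<2 * pi} (memory_integrand M \<kappa>\<^sub>1 \<kappa>\<^sub>2 \<Psi>)"
proof -
  define A where "A \<xi> = lattice_symbol M \<kappa>\<^sub>1 \<kappa>\<^sub>2 \<xi>" for \<xi>
  define u where "u \<xi> = hat_symbol M \<xi>" for \<xi>
  \<comment> \<open>This is the inverse of \<open>A \<xi>\<close> applied to \<open>u \<xi>\<close>,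
    written through the adjugate. The endpoints are left out because constant vectors lie in the
    kernel of the symbol there.\<close>
  define x where "x \<xi> = (1 / Determinant.det (A \<xi>)) \<cdot>\<^sub>v (adj_mat (A \<xi>) *\<^sub>v u \<xi>)" for \<xi>
  have A: "A \<xi> \<in> carrier_mat M M" and u: "u \<xi> \<in> carrier_vec M" for \<xi> by (simp_all add: A_def u_def)
  have adj: "adj_mat (A \<xi>) *\<^sub>v u \<xi> \<in> carrier_vec M" for \<xi>
    using adj_mat(1)[OF A] u by (rule mult_mat_vec_carrier)
  have x: "x \<xi> \<in> carrier_vec M" for \<xi> using adj by (simp add: x_def)
  have det: "Determinant.det (A \<xi>) \<noteq> 0" if "\<xi> \<in> {0<..<2 * pi}" for \<xi>
  proof
    assume "Determinant.det (A \<xi>) = 0"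
    then obtain v where v: "v \<in> carrier_vec M" "v \<noteq> 0\<^sub>v M" "A \<xi> *\<^sub>v v = 0\<^sub>v M"
      using det_0_iff_vec_prod_zero_field[OF A] by blast
    then have "(A \<xi> *\<^sub>v v) \<bullet>c v = 0" by simp
    then show False
      using lattice_symbol_definite[OF M \<kappa> _ v(1), of \<xi>] that v(2) by (simp add: A_def)
  qed
  have integrand: "x \<xi> \<bullet>c u \<xi> \<noteq> 0" "memory_integrand M \<kappa>\<^sub>1 \<kappa>\<^sub>2 \<Psi> \<xi>
      = of_real (hat_energy M \<kappa>\<^sub>1 \<kappa>\<^sub>2 \<xi>) - (u \<xi> \<bullet>c u \<xi>)\<^sup>2 / (x \<xi> \<bullet>c u \<xi>)" if \<xi>: "\<xi> \<in> {0<..<2 * pi}" for \<xi>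
  proof -
    have \<xi>': "\<xi> \<in> {0<..2 * pi}" using \<xi> by simp
    have "A \<xi> *\<^sub>v x \<xi> = u \<xi>" unfolding x_def using adj_mat_solves[OF A u det[OF \<xi>]] .
    with memory_integrand_bounds(3)[where \<Psi> = \<Psi>, OF M \<kappa> \<xi>' basis[OF \<xi>'] x[of \<xi>]]
    show "x \<xi> \<bullet>c u \<xi> \<noteq> 0" "memory_integrand M \<kappa>\<^sub>1 \<kappa>\<^sub>2 \<Psi> \<xi>
      = of_real (hat_energy M \<kappa>\<^sub>1 \<kappa>\<^sub>2 \<xi>) - (u \<xi> \<bullet>c u \<xi>)\<^sup>2 / (x \<xi> \<bullet>c u \<xi>)"
      by (simp_all add: A_def u_def)
  qed
  have x_index: "x \<xi> $ i = (\<Sum>j<M. adj_mat (A \<xi>) $$ (i, j) * u \<xi> $ j) / Determinant.det (A \<xi>)" if "i < M" for \<xi> i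
    using that carrier_vecD[OF adj[of \<xi>]] mult_mat_vec_index_sum[OF adj_mat(1)[OF A] u that]
    by (simp add: x_def del: dim_mult_mat_vec)
  have cont_A: "continuous_on S (\<lambda>\<xi>. A \<xi> $$ (i, j))" if "i < M" "j < M" for i j S
    unfolding A_def using continuous_on_lattice_symbol[OF M that] .
  have cont_u: "continuous_on S (\<lambda>\<xi>. u \<xi> $ i)" if "i < M" for i S
    unfolding u_def using continuous_on_hat_symbol[OF M that] .
  have cont_x: "continuous_on {0<..<2 * pi} (\<lambda>\<xi>. x \<xi> $ i)" if "i < M" for i
  proof -
    have "continuous_on {0<..<2 * pi}
        (\<lambda>\<xi>. (\<Sum>j<M. adj_mat (A \<xi>) $$ (i, j) * u \<xi> $ j) / Determinant.det (A \<xi>))"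
      using det that
      by (intro continuous_on_divide continuous_on_sum continuous_on_mult
          continuous_on_adj_mat[OF A] continuous_on_det[OF A] cont_A cont_u) auto
    then show ?thesis by (simp only: x_index[OF that])
  qed
  have cont_energy: "continuous_on S (\<lambda>\<xi>. hat_energy M \<kappa>\<^sub>1 \<kappa>\<^sub>2 \<xi>)" for S
    unfolding hat_energy_def using hat_norm_pos[OF M] by (intro continuous_intros) auto
  have "continuous_on {0<..<2 * pi} (\<lambda>\<xi>. x \<xi> \<bullet>c u \<xi>)" "continuous_on {0<..<2 * pi} (\<lambda>\<xi>. u \<xi> \<bullet>c u \<xi>)"
    unfolding cscalar_prod_sum[OF u] by (intro continuous_intros cont_x cont_u; simp)+
  then have "continuous_on {0<..<2 * pi}
      (\<lambda>\<xi>. of_real (hat_energy M \<kappa>\<^sub>1 \<kappa>\<^sub>2 \<xi>) - (u \<xi> \<bullet>c u \<xi>)\<^sup>2 / (x \<xi> \<bullet>c u \<xi>))"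
    using integrand(1) by (intro continuous_intros cont_energy) auto
  then show ?thesis by (rule continuous_on_eq) (simp only: integrand(2))
qed

section \<open>The bound on the memory kernel at time zero\<close>

theorem theorem2:
  fixes M :: nat and \<kappa>\<^sub>1 \<kappa>\<^sub>2 :: real and \<Psi> :: "real \<Rightarrow> complex mat"
  assumes "M \<ge> 2" and "\<kappa>\<^sub>1 > 0" and "\<kappa>\<^sub>1 + 4 * \<kappa>\<^sub>2 > 0"
    and "\<And>\<xi>. \<xi> \<in> {0<..2 * pi} \<Longrightarrow> cols_basis_orth_compl M (hat_symbol M \<xi>) (\<Psi> \<xi>)"
  shows "(\<forall>\<xi>\<in>{0<..2 * pi}. invertible_mat (Omega_sq_symbol M \<kappa>\<^sub>1 \<kappa>\<^sub>2 \<Psi> \<xi>)) \<and>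
         memory_integrand M \<kappa>\<^sub>1 \<kappa>\<^sub>2 \<Psi> integrable_on {0..2 * pi} \<and>
         memory_kernel_00 M \<kappa>\<^sub>1 \<kappa>\<^sub>2 \<Psi> \<in> \<real> \<and>
         Re (memory_kernel_00 M \<kappa>\<^sub>1 \<kappa>\<^sub>2 \<Psi>) \<le>
           (2 * real M * \<kappa>\<^sub>1 + 8 * real M * \<kappa>\<^sub>2 - 6 * \<kappa>\<^sub>2) / (real M * (2 * real M ^ 2 + 1) / 3)"
proof -
  let ?f = "memory_integrand M \<kappa>\<^sub>1 \<kappa>\<^sub>2 \<Psi>" and ?E = "hat_energy M \<kappa>\<^sub>1 \<kappa>\<^sub>2"
  let ?b = "(2 * real M * \<kappa>\<^sub>1 + 8 * real M * \<kappa>\<^sub>2 - 6 * \<kappa>\<^sub>2) / (hat_norm M)\<^sup>2"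
  note bounds = memory_integrand_bounds[where \<Psi> = \<Psi>, OF assms(1-3)]
  define h where "h \<xi> = Re (?f \<xi>)" for \<xi>
  have f: "?f \<xi> = of_real (h \<xi>)" and h: "0 \<le> h \<xi>" "h \<xi> \<le> ?E \<xi>" if "\<xi> \<in> {0<..<2 * pi}" for \<xi>
    using bounds(2)[of \<xi>, OF _ assms(4)] that by (auto simp: h_def)
  \<comment> \<open>The matrix \<open>\<Psi> 0\<close> is unconstrained, so the estimates are made
    on the open interval; the two endpoints do not affect the integrals.\<close>
  have E: "(?E has_integral 2 * pi * ?b) {0<..<2 * pi}"
    using hat_energy_has_integral by (simp only: has_integral_Icc_iff_Ioo)
  have "continuous_on {0<..<2 * pi} h"
    unfolding h_def by (intro continuous_intros continuous_on_memory_integrand[OF assms])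
  then have "h \<in> borel_measurable (lebesgue_on {0<..<2 * pi})"
    by (intro continuous_imp_measurable_on_sets_lebesgue) auto
  \<comment> \<open>Continuity on the open interval alone does not give integrability; the bound
    \<open>0 \<le> h \<le> ?E\<close> with \<open>?E\<close> integrable does, once \<open>h\<close>
    is measurable.\<close>
  then have "h integrable_on {0<..<2 * pi}"
    using E h by (intro measurable_bounded_by_integrable_imp_integrable[of h _ ?E]) auto
  then obtain I where I: "(h has_integral I) {0<..<2 * pi}" by blast
  have "I \<le> 2 * pi * ?b" using has_integral_le[OF I E] h(2) by blast
  then have I_le: "I / (2 * pi) \<le> ?b" by (simp add: divide_le_eq mult.commute)
  have "((\<lambda>\<xi>. complex_of_real (h \<xi>)) has_integral of_real I) {0<..<2 * pi}"
    using I by (rule has_integral_of_real)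
  then have "(?f has_integral of_real I) {0<..<2 * pi}"
    using f by (subst has_integral_cong) auto
  then have fI: "(?f has_integral of_real I) {0..2 * pi}" by (simp only: has_integral_Icc_iff_Ioo)
  then have "memory_kernel_00 M \<kappa>\<^sub>1 \<kappa>\<^sub>2 \<Psi> = of_real (I / (2 * pi))"
    by (simp add: memory_kernel_00_def integral_unique)
  then show ?thesis
    using bounds(1)[OF _ assms(4)] fI I_le by (auto simp: hat_norm_sq integrable_on_def)
qed

end
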